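(* Let $(\mathcal{G},\omega,\eta)\rightrightarrows M$ be a cosymplectic groupoid with connected space of arrows and Reeb vector field $\xi$, and let $G$ be a Lie group with Lie algebra $\mathfrak{g}$ acting on $\mathcal{G}\rightrightarrows M$ by cosymplectic groupoid automorphisms, with the action on $M$ free and proper. Let $\mathcal{J}:\mathcal{G}\to\mathfrak{g}^*$ be a cosymplectic moment map which is a Lie groupoid morphism and satisfies $\xi(\langle\mathcal{J},v\rangle)=0$ for all $v\in\mathfrak{g}$. Let $\Sigma$ be the symplectic leaf of $\mathcal{G}$ containing $M$, let $L:\Sigma\to\mathcal{G}$ be the inclusion, and let $\mathcal{J}_0=\mathcal{J}\circ L$. Then $$L_{red}^*\omega_{red}=(L^*\omega)_{red},$$ where $L_{red}:\mathcal{J}_0^{-1}(0)/G\to\mathcal{J}^{-1}(0)/G$ is the map induced by $L$.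
   Context: A cosymplectic manifold $(Q,\omega,\eta)$ is a manifold of dimension $2n+1$ with closed forms $\omega\in\Omega^2(Q)$, $\eta\in\Omega^1(Q)$ such that $\omega^n\wedge\eta$ is a volume form. The Reeb vector field $\xi$ is determined by $\imath_\xi\omega=0$, $\imath_\xi\eta=1$; the Hamiltonian vector field $X_f$ by $\imath_{X_f}\omega=df-\xi(f)\eta$, $\imath_{X_f}\eta=0$. $Q$ carries the Poisson structure $\pi_Q$ with bracket $\{f,g\}=\omega(X_f,X_g)$, whose symplectic leaves are the leaves of the foliation $\ker\eta$, with symplectic form the restriction of $\omega$. If $G$ acts on $Q$ preserving $\omega,\eta$, a cosymplectic moment map is a smooth map $J:Q\to\mathfrak{g}^*$, equivariant for the coadjoint action, with $X_{\langle J,v\rangle}=v_Q$ (the fundamental vector field) for all $v\in\mathfrak{g}$. A form $\theta$ on a Lie groupoid is multiplicative if $m^*\theta=pr_1^*\theta+pr_2^*\theta$ on composable arrows. A cosymplectic groupoid is a Lie groupoid $\mathcal{G}\rightrightarrows M$ with closed multiplicative forms $\omega\in\Omega^2(\mathcal{G})$, $\eta\in\Omega^1(\mathcal{G})$ such that $\mathrm{rank}(\omega_x)=2\dim M$ for all units $x\in M$ and $(\mathcal{G},\omega,\eta)$ is a cosymplectic manifold. $G$ acts by cosymplectic groupoid automorphisms if each $g\in G$ acts by a Lie groupoid automorphism preserving $\omega$ and $\eta$. $\mathfrak{g}^*$ is regarded as an abelian group under addition. Known facts used in the statement: $(\Sigma,L^*\omega)\rightrightarrows M$ is a symplectic groupoid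 and a Lie subgroupoid of $\mathcal{G}$. The $G$-action restricts to an action on $\Sigma$ by symplectic groupoid automorphisms, and $\mathcal{J}_0$ is a symplectic moment map for it. Reduced forms: $\mathcal{J}^{-1}(0)/G$ is a cosymplectic groupoid over $M/G$ with $\omega_{red}$ defined by $i^*\omega=P^*\omega_{red}$, where $i:\mathcal{J}^{-1}(0)\to\mathcal{G}$ is the inclusion and $P:\mathcal{J}^{-1}(0)\to\mathcal{J}^{-1}(0)/G$ the projection. $(L^*\omega)_{red}$ is the Marsden-Weinstein reduced symplectic form on $\mathcal{J}_0^{-1}(0)/G$, defined by $L_0^*(L^*\omega)=P_0^*(L^*\omega)_{red}$, where $L_0:\mathcal{J}_0^{-1}(0)\to\Sigma$ is the inclusion and $P_0:\mathcal{J}_0^{-1}(0)\to\mathcal{J}_0^{-1}(0)/G$ the projection. The map $L$ restricts to a $G$-equivariant map $\mathcal{J}_0^{-1}(0)\to\mathcal{J}^{-1}(0)$, which descends to $L_{red}$. *)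

theory Defs
  imports "HOL-Analysis.Analysis" "HOL-Combinatorics.Permutations"
    "HOL-Library.Function_Algebras" "HOL-Algebra.Group"
begin

section \<open>Smooth functions on open subsets of Euclidean space\<close>

text \<open>Iterated partial derivatives. \<open>U\<close> is meant to be open in \<open>Euclidean_space n\<close>, so
  \<open>x(i := t)\<close> stays in \<open>U\<close> for \<open>t\<close> near \<open>x i\<close>.\<close>

primrec Ck :: "nat \<Rightarrow> nat \<Rightarrow> (nat \<Rightarrow> real) set \<Rightarrow> ((nat \<Rightarrow> real) \<Rightarrow> real) \<Rightarrow> bool" where
  "Ck 0 n U f \<longleftrightarrow> continuous_map (subtopology (Euclidean_space n) U) euclideanreal f"
| "Ck (Suc k) n U f \<longleftrightarrow>
     continuous_map (subtopology (Euclidean_space n) U) euclideanreal f \<and>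
     (\<forall>i<n. \<exists>g. (\<forall>x\<in>U. ((\<lambda>t. f (x(i := t))) has_real_derivative g x) (at (x i))) \<and> Ck k n U g)"

definition smooth_Euclid :: "nat \<Rightarrow> (nat \<Rightarrow> real) set \<Rightarrow> ((nat \<Rightarrow> real) \<Rightarrow> real) set" where
  "smooth_Euclid n U = {f. \<forall>k. Ck k n U f}"


section \<open>Smooth manifolds\<close>

text \<open>A smooth manifold is a Hausdorff second countable space with a functional structure (a sheaf
  of algebras of continuous real functions) that is locally isomorphic to \<open>\<real>\<^sup>n\<close> with its smooth
  functions; see Bredon, Topology and Geometry, II.2. This is the atlas definition with the atlas
  given by all \<open>chart\<close>s. \<open>msm X U\<close> is the set of smooth functions on the open set \<open>U\<close>; functions
  are total, and their values off \<open>U\<close> are irrelevant. The dimension \<open>n\<close> may be 0.\<close>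

record 'a mfd =
  mtop :: "'a topology"
  msm :: "'a set \<Rightarrow> ('a \<Rightarrow> real) set"

abbreviation pts :: "'a mfd \<Rightarrow> 'a set" where "pts X \<equiv> topspace (mtop X)"

abbreviation Csm :: "'a mfd \<Rightarrow> ('a \<Rightarrow> real) set" where "Csm X \<equiv> msm X (pts X)"

definition functional_structure :: "'a mfd \<Rightarrow> bool" where
  "functional_structure X \<longleftrightarrow>
     (\<forall>U f g. openin (mtop X) U \<longrightarrow> f \<in> msm X U \<longrightarrow> (\<forall>x\<in>U. f x = g x) \<longrightarrow> g \<in> msm X U) \<and>
     (\<forall>U f. openin (mtop X) U \<longrightarrow> f \<in> msm X U \<longrightarrow>
        continuous_map (subtopology (mtop X) U) euclideanreal f) \<and>
     (\<forall>U c. openin (mtop X) U \<longrightarrow> (\<lambda>_. c) \<in> msm X U) \<and>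
     (\<forall>U f g. openin (mtop X) U \<longrightarrow> f \<in> msm X U \<longrightarrow> g \<in> msm X U \<longrightarrow>
        (\<lambda>x. f x + g x) \<in> msm X U \<and> (\<lambda>x. f x * g x) \<in> msm X U) \<and>
     (\<forall>U V f. openin (mtop X) U \<longrightarrow> openin (mtop X) V \<longrightarrow> V \<subseteq> U \<longrightarrow> f \<in> msm X U \<longrightarrow> f \<in> msm X V) \<and>
     (\<forall>\<U> f. (\<forall>U\<in>\<U>. openin (mtop X) U \<and> f \<in> msm X U) \<longrightarrow> f \<in> msm X (\<Union>\<U>))"

definition chart :: "'a mfd \<Rightarrow> nat \<Rightarrow> 'a set \<Rightarrow> ('a \<Rightarrow> nat \<Rightarrow> real) \<Rightarrow> bool" where
  "chart X n U \<phi> \<longleftrightarrow>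
     openin (mtop X) U \<and> openin (Euclidean_space n) (\<phi> ` U) \<and>
     homeomorphic_map (subtopology (mtop X) U) (subtopology (Euclidean_space n) (\<phi> ` U)) \<phi> \<and>
     (\<forall>V f. openin (mtop X) V \<longrightarrow> V \<subseteq> U \<longrightarrow>
        (f \<in> msm X V \<longleftrightarrow> f \<circ> inv_into U \<phi> \<in> smooth_Euclid n (\<phi> ` V)))"

definition manifold :: "nat \<Rightarrow> 'a mfd \<Rightarrow> bool" where
  "manifold n X \<longleftrightarrow> functional_structure X \<and>
     Hausdorff_space (mtop X) \<and> second_countable (mtop X) \<and>
     (\<forall>p\<in>pts X. \<exists>U \<phi>. p \<in> U \<and> chart X n U \<phi>)"

definition smooth_map :: "'a mfd \<Rightarrow> 'b mfd \<Rightarrow> ('a \<Rightarrow> 'b) \<Rightarrow> bool" where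
  "smooth_map X Y F \<longleftrightarrow> continuous_map (mtop X) (mtop Y) F \<and>
     (\<forall>V h. openin (mtop Y) V \<longrightarrow> h \<in> msm Y V \<longrightarrow> h \<circ> F \<in> msm X {x \<in> pts X. F x \<in> V})"

text \<open>The structure of an embedded submanifold on a subset \<open>S\<close>: the subspace topology, and the
  functions that extend locally to smooth functions of the ambient manifold.\<close>

definition sub_mfd :: "'a mfd \<Rightarrow> 'a set \<Rightarrow> 'a mfd" where
  "sub_mfd X S = \<lparr>mtop = subtopology (mtop X) S,
     msm = (\<lambda>U. {f. \<forall>p\<in>U. \<exists>V h. openin (mtop X) V \<and> p \<in> V \<and> h \<in> msm X V \<and> (\<forall>x\<in>V \<inter> U. f x = h x)})\<rparr>"

text \<open>Product manifold: smoothness is tested in products of charts, where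
  \<open>\<real>\<^sup>m\<^sup>+\<^sup>n\<close> is split into its first \<open>m\<close> and its last \<open>n\<close> coordinates.\<close>

definition first_part :: "nat \<Rightarrow> (nat \<Rightarrow> real) \<Rightarrow> (nat \<Rightarrow> real)" where
  "first_part m z = (\<lambda>i. if i < m then z i else 0)"

definition last_part :: "nat \<Rightarrow> (nat \<Rightarrow> real) \<Rightarrow> (nat \<Rightarrow> real)" where
  "last_part m z = (\<lambda>i. z (m + i))"

definition prod_mfd :: "'a mfd \<Rightarrow> 'b mfd \<Rightarrow> ('a \<times> 'b) mfd" where
  "prod_mfd X Y = \<lparr>mtop = prod_topology (mtop X) (mtop Y),
     msm = (\<lambda>W. {f. \<forall>(x, y)\<in>W. \<exists>m n U V \<phi> \<psi>. chart X m U \<phi> \<and> chart Y n V \<psi> \<and>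
        x \<in> U \<and> y \<in> V \<and> U \<times> V \<subseteq> W \<and>
        (\<lambda>z. f (inv_into U \<phi> (first_part m z), inv_into V \<psi> (last_part m z)))
          \<in> smooth_Euclid (m + n)
              {z \<in> topspace (Euclidean_space (m + n)). first_part m z \<in> \<phi> ` U \<and> last_part m z \<in> \<psi> ` V}})\<rparr>"


section \<open>Tangent vectors, vector fields and forms\<close>

text \<open>Tangent vectors at \<open>p\<close> are the derivations of \<open>C\<^sup>\<infinity>(X)\<close> at \<open>p\<close>. As total functions they
  vanish off \<open>C\<^sup>\<infinity>(X)\<close>. They do not see values off \<open>pts X\<close>: a \<open>d\<close> vanishing on \<open>pts X\<close>
  equals \<open>d\<close> times the (smooth) indicator of the complement, so the Leibniz rule gives \<open>v d = 0\<close>.\<close>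

type_synonym 'a tvec = "('a \<Rightarrow> real) \<Rightarrow> real"

definition tspace :: "'a mfd \<Rightarrow> 'a \<Rightarrow> 'a tvec set" where
  "tspace X p = {v. (\<forall>f. f \<notin> Csm X \<longrightarrow> v f = 0) \<and>
     (\<forall>f\<in>Csm X. \<forall>g\<in>Csm X. \<forall>a b. v (\<lambda>x. a * f x + b * g x) = a * v f + b * v g) \<and>
     (\<forall>f\<in>Csm X. \<forall>g\<in>Csm X. v (\<lambda>x. f x * g x) = f p * v g + g p * v f)}"

definition push :: "'b mfd \<Rightarrow> ('a \<Rightarrow> 'b) \<Rightarrow> 'a tvec \<Rightarrow> 'b tvec" where
  "push Y F v = (\<lambda>h. if h \<in> Csm Y then v (h \<circ> F) else 0)"

definition submersion :: "'a mfd \<Rightarrow> 'b mfd \<Rightarrow> ('a \<Rightarrow> 'b) \<Rightarrow> bool" where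
  "submersion X Y F \<longleftrightarrow> smooth_map X Y F \<and> (\<forall>p\<in>pts X. push Y F ` tspace X p = tspace Y (F p))"

definition vector_field :: "'a mfd \<Rightarrow> ('a \<Rightarrow> 'a tvec) \<Rightarrow> bool" where
  "vector_field X A \<longleftrightarrow> (\<forall>p\<in>pts X. A p \<in> tspace X p) \<and> (\<forall>f\<in>Csm X. (\<lambda>p. A p f) \<in> Csm X)"

definition lie_bracket :: "'a mfd \<Rightarrow> ('a \<Rightarrow> 'a tvec) \<Rightarrow> ('a \<Rightarrow> 'a tvec) \<Rightarrow> 'a \<Rightarrow> 'a tvec" where
  "lie_bracket X A B p =
     (\<lambda>f. if f \<in> Csm X then A p (\<lambda>q. B q f) - B p (\<lambda>q. A q f) else 0)"

text \<open>Forms are total functions, set to 0 outside the points and tangent vectors of \<open>X\<close>, so that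
  two forms on \<open>X\<close> are equal iff they are equal as functions.\<close>

type_synonym 'a form1 = "'a \<Rightarrow> 'a tvec \<Rightarrow> real"
type_synonym 'a form2 = "'a \<Rightarrow> 'a tvec \<Rightarrow> 'a tvec \<Rightarrow> real"

definition linear_functional :: "'a mfd \<Rightarrow> 'a \<Rightarrow> ('a tvec \<Rightarrow> real) \<Rightarrow> bool" where
  "linear_functional X p \<mu> \<longleftrightarrow> (\<forall>v. v \<notin> tspace X p \<longrightarrow> \<mu> v = 0) \<and>
     (\<forall>v\<in>tspace X p. \<forall>w\<in>tspace X p. \<forall>a b. \<mu> (\<lambda>f. a * v f + b * w f) = a * \<mu> v + b * \<mu> w)"

definition one_form :: "'a mfd \<Rightarrow> 'a form1 \<Rightarrow> bool" where
  "one_form X \<theta> \<longleftrightarrow>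
     (\<forall>p. p \<notin> pts X \<longrightarrow> \<theta> p = (\<lambda>_. 0)) \<and>
     (\<forall>p\<in>pts X. linear_functional X p (\<theta> p)) \<and>
     (\<forall>A. vector_field X A \<longrightarrow> (\<lambda>p. \<theta> p (A p)) \<in> Csm X)"

definition two_form :: "'a mfd \<Rightarrow> 'a form2 \<Rightarrow> bool" where
  "two_form X \<theta> \<longleftrightarrow>
     (\<forall>p. p \<notin> pts X \<longrightarrow> \<theta> p = (\<lambda>_ _. 0)) \<and>
     (\<forall>p\<in>pts X. (\<forall>v. linear_functional X p (\<lambda>w. \<theta> p v w)) \<and>
                 (\<forall>w. linear_functional X p (\<lambda>v. \<theta> p v w)) \<and> (\<forall>v. \<theta> p v v = 0)) \<and>
     (\<forall>A B. vector_field X A \<longrightarrow> vector_field X B \<longrightarrow> (\<lambda>p. \<theta> p (A p) (B p)) \<in> Csm X)"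

definition pullback1 :: "'a mfd \<Rightarrow> 'b mfd \<Rightarrow> ('a \<Rightarrow> 'b) \<Rightarrow> 'b form1 \<Rightarrow> 'a form1" where
  "pullback1 X Y F \<theta> = (\<lambda>p v. if p \<in> pts X \<and> v \<in> tspace X p then \<theta> (F p) (push Y F v) else 0)"

definition pullback2 :: "'a mfd \<Rightarrow> 'b mfd \<Rightarrow> ('a \<Rightarrow> 'b) \<Rightarrow> 'b form2 \<Rightarrow> 'a form2" where
  "pullback2 X Y F \<theta> =
     (\<lambda>p v w. if p \<in> pts X \<and> v \<in> tspace X p \<and> w \<in> tspace X p
               then \<theta> (F p) (push Y F v) (push Y F w) else 0)"

text \<open>Exterior derivatives, by the invariant formula on vector fields.\<close>

definition ext_deriv1 :: "'a mfd \<Rightarrow> 'a form1 \<Rightarrow> ('a \<Rightarrow> 'a tvec) \<Rightarrow> ('a \<Rightarrow> 'a tvec) \<Rightarrow> 'a \<Rightarrow> real" where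
  "ext_deriv1 X \<theta> A B p =
     A p (\<lambda>q. \<theta> q (B q)) - B p (\<lambda>q. \<theta> q (A q)) - \<theta> p (lie_bracket X A B p)"

definition ext_deriv2 ::
    "'a mfd \<Rightarrow> 'a form2 \<Rightarrow> ('a \<Rightarrow> 'a tvec) \<Rightarrow> ('a \<Rightarrow> 'a tvec) \<Rightarrow> ('a \<Rightarrow> 'a tvec) \<Rightarrow> 'a \<Rightarrow> real" where
  "ext_deriv2 X \<theta> A B C p =
     A p (\<lambda>q. \<theta> q (B q) (C q)) - B p (\<lambda>q. \<theta> q (A q) (C q)) + C p (\<lambda>q. \<theta> q (A q) (B q))
     - \<theta> p (lie_bracket X A B p) (C p) + \<theta> p (lie_bracket X A C p) (B p)
     - \<theta> p (lie_bracket X B C p) (A p)"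

definition closed_form1 :: "'a mfd \<Rightarrow> 'a form1 \<Rightarrow> bool" where
  "closed_form1 X \<theta> \<longleftrightarrow> one_form X \<theta> \<and>
     (\<forall>A B. vector_field X A \<longrightarrow> vector_field X B \<longrightarrow> (\<forall>p\<in>pts X. ext_deriv1 X \<theta> A B p = 0))"

definition closed_form2 :: "'a mfd \<Rightarrow> 'a form2 \<Rightarrow> bool" where
  "closed_form2 X \<theta> \<longleftrightarrow> two_form X \<theta> \<and>
     (\<forall>A B C. vector_field X A \<longrightarrow> vector_field X B \<longrightarrow> vector_field X C \<longrightarrow>
        (\<forall>p\<in>pts X. ext_deriv2 X \<theta> A B C p = 0))"

text \<open>\<open>\<omega>\<^sup>n \<and> \<eta>\<close> evaluated on the tuple \<open>v 0, \<dots>, v (2 * n)\<close>.\<close>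

definition wedge_power :: "nat \<Rightarrow> 'a form2 \<Rightarrow> 'a form1 \<Rightarrow> 'a \<Rightarrow> (nat \<Rightarrow> 'a tvec) \<Rightarrow> real" where
  "wedge_power n \<omega> \<eta> p v =
     (\<Sum>\<sigma> | \<sigma> permutes {..<2 * n + 1}.
        of_int (sign \<sigma>) * (\<Prod>i<n. \<omega> p (v (\<sigma> (2 * i))) (v (\<sigma> (2 * i + 1)))) * \<eta> p (v (\<sigma> (2 * n)))) / 2 ^ n"

text \<open>Rank of the linear map \<open>v \<mapsto> \<omega>\<^sub>p(v, \<cdot>)\<close> from the tangent space to its dual.\<close>

definition form_rank :: "'a mfd \<Rightarrow> 'a form2 \<Rightarrow> 'a \<Rightarrow> nat" where
  "form_rank X \<omega> p =
     vector_space.dim (\<lambda>(c::real) (\<mu>::'a tvec \<Rightarrow> real) w. c * \<mu> w) (\<omega> p ` tspace X p)"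


section \<open>Cosymplectic manifolds\<close>

definition cosymplectic_manifold :: "'a mfd \<Rightarrow> 'a form2 \<Rightarrow> 'a form1 \<Rightarrow> bool" where
  "cosymplectic_manifold Q \<omega> \<eta> \<longleftrightarrow>
     closed_form2 Q \<omega> \<and> closed_form1 Q \<eta> \<and>
     (\<exists>n. manifold (2 * n + 1) Q \<and>
          (\<forall>p\<in>pts Q. \<exists>v. (\<forall>i<2 * n + 1. v i \<in> tspace Q p) \<and> wedge_power n \<omega> \<eta> p v \<noteq> 0))"

definition reeb_field :: "'a mfd \<Rightarrow> 'a form2 \<Rightarrow> 'a form1 \<Rightarrow> ('a \<Rightarrow> 'a tvec) \<Rightarrow> bool" where
  "reeb_field Q \<omega> \<eta> \<xi> \<longleftrightarrow> vector_field Q \<xi> \<and>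
     (\<forall>p\<in>pts Q. (\<forall>w\<in>tspace Q p. \<omega> p (\<xi> p) w = 0) \<and> \<eta> p (\<xi> p) = 1)"

definition hamiltonian_field ::
    "'a mfd \<Rightarrow> 'a form2 \<Rightarrow> 'a form1 \<Rightarrow> ('a \<Rightarrow> 'a tvec) \<Rightarrow> ('a \<Rightarrow> real) \<Rightarrow> ('a \<Rightarrow> 'a tvec) \<Rightarrow> bool" where
  "hamiltonian_field Q \<omega> \<eta> \<xi> f A \<longleftrightarrow> vector_field Q A \<and>
     (\<forall>p\<in>pts Q. (\<forall>w\<in>tspace Q p. \<omega> p (A p) w = w f - \<xi> p f * \<eta> p w) \<and> \<eta> p (A p) = 0)"

text \<open>The symplectic leaves are the leaves of the foliation \<open>ker \<eta>\<close>, i.e. its maximal connected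
  integral manifolds. A leaf is in general only immersed, so it carries its own manifold structure.\<close>

definition integral_manifold :: "'a mfd \<Rightarrow> 'a form1 \<Rightarrow> 'a mfd \<Rightarrow> bool" where
  "integral_manifold Q \<eta> S \<longleftrightarrow>
     (\<exists>k. manifold k S) \<and> pts S \<noteq> {} \<and> connected_space (mtop S) \<and>
     pts S \<subseteq> pts Q \<and> smooth_map S Q id \<and>
     (\<forall>p\<in>pts S. inj_on (push Q id) (tspace S p) \<and>
                 push Q id ` tspace S p = {v \<in> tspace Q p. \<eta> p v = 0})"

definition symplectic_leaf :: "'a mfd \<Rightarrow> 'a form1 \<Rightarrow> 'a mfd \<Rightarrow> bool" where
  "symplectic_leaf Q \<eta> S \<longleftrightarrow> integral_manifold Q \<eta> S \<and>
     (\<forall>S'. integral_manifold Q \<eta> S' \<longrightarrow> pts S \<subseteq> pts S' \<longrightarrow> pts S' = pts S)"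


section \<open>Lie groups, actions and moment maps\<close>

definition lie_group :: "'g monoid \<Rightarrow> 'g mfd \<Rightarrow> bool" where
  "lie_group G K \<longleftrightarrow> group G \<and> pts K = carrier G \<and> (\<exists>n. manifold n K) \<and>
     smooth_map (prod_mfd K K) K (\<lambda>(g, h). mult G g h) \<and> smooth_map K K (m_inv G)"

text \<open>The Lie algebra, as a vector space, and its adjoint action.\<close>

abbreviation lie_algebra :: "'g monoid \<Rightarrow> 'g mfd \<Rightarrow> 'g tvec set" where
  "lie_algebra G K \<equiv> tspace K (one G)"

definition Ad :: "'g monoid \<Rightarrow> 'g mfd \<Rightarrow> 'g \<Rightarrow> 'g tvec \<Rightarrow> 'g tvec" where
  "Ad G K g = push K (\<lambda>h. mult G (mult G g h) (m_inv G g))"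

definition smooth_action :: "'g monoid \<Rightarrow> 'g mfd \<Rightarrow> 'a mfd \<Rightarrow> ('g \<Rightarrow> 'a \<Rightarrow> 'a) \<Rightarrow> bool" where
  "smooth_action G K X act \<longleftrightarrow>
     (\<forall>g\<in>carrier G. \<forall>x\<in>pts X. act g x \<in> pts X) \<and>
     (\<forall>x\<in>pts X. act (one G) x = x) \<and>
     (\<forall>g\<in>carrier G. \<forall>h\<in>carrier G. \<forall>x\<in>pts X. act (mult G g h) x = act g (act h x)) \<and>
     smooth_map (prod_mfd K X) X (\<lambda>(g, x). act g x)"

definition free_action :: "'g monoid \<Rightarrow> 'a mfd \<Rightarrow> ('g \<Rightarrow> 'a \<Rightarrow> 'a) \<Rightarrow> bool" where
  "free_action G X act \<longleftrightarrow> (\<forall>g\<in>carrier G. \<forall>x\<in>pts X. act g x = x \<longrightarrow> g = one G)"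

definition proper_action :: "'g mfd \<Rightarrow> 'a mfd \<Rightarrow> ('g \<Rightarrow> 'a \<Rightarrow> 'a) \<Rightarrow> bool" where
  "proper_action K X act \<longleftrightarrow>
     proper_map (prod_topology (mtop K) (mtop X)) (prod_topology (mtop X) (mtop X))
       (\<lambda>(g, x). (act g x, x))"

text \<open>\<open>v\<^sub>Q(x) = d/dt exp(tv) x\<close> at \<open>t = 0\<close>, the image of \<open>v\<close> under the derivative of the orbit map.\<close>

definition fundamental_field :: "'a mfd \<Rightarrow> ('g \<Rightarrow> 'a \<Rightarrow> 'a) \<Rightarrow> 'g tvec \<Rightarrow> 'a \<Rightarrow> 'a tvec" where
  "fundamental_field X act v x = push X (\<lambda>g. act g x) v"

text \<open>The dual of the Lie algebra consists of the linear functionals on it, extended by 0. It carries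
  the smooth structure of a finite-dimensional vector space, so a map into it is smooth iff
  all pairings with elements of the Lie algebra are.\<close>

definition cosymplectic_moment_map ::
    "'g monoid \<Rightarrow> 'g mfd \<Rightarrow> 'a mfd \<Rightarrow> 'a form2 \<Rightarrow> 'a form1 \<Rightarrow> ('a \<Rightarrow> 'a tvec) \<Rightarrow>
     ('g \<Rightarrow> 'a \<Rightarrow> 'a) \<Rightarrow> ('a \<Rightarrow> 'g tvec \<Rightarrow> real) \<Rightarrow> bool" where
  "cosymplectic_moment_map G K Q \<omega> \<eta> \<xi> act J \<longleftrightarrow>
     (\<forall>x\<in>pts Q. linear_functional K (one G) (J x)) \<and>
     (\<forall>v\<in>lie_algebra G K. (\<lambda>x. J x v) \<in> Csm Q) \<and>
     (\<forall>g\<in>carrier G. \<forall>x\<in>pts Q. \<forall>v\<in>lie_algebra G K.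
        J (act g x) v = J x (Ad G K (m_inv G g) v)) \<and>
     (\<forall>v\<in>lie_algebra G K.
        hamiltonian_field Q \<omega> \<eta> \<xi> (\<lambda>x. J x v) (fundamental_field Q act v))"

definition zero_level :: "'a mfd \<Rightarrow> ('a \<Rightarrow> 'g tvec \<Rightarrow> real) \<Rightarrow> 'a mfd" where
  "zero_level X J = sub_mfd X {x \<in> pts X. J x = (\<lambda>_. 0)}"

definition orbit :: "'g monoid \<Rightarrow> ('g \<Rightarrow> 'a \<Rightarrow> 'a) \<Rightarrow> 'a \<Rightarrow> 'a set" where
  "orbit G act x = (\<lambda>g. act g x) ` carrier G"

text \<open>\<open>N\<close> is the quotient manifold of \<open>X\<close> by the map \<open>P\<close>: the manifold with the quotient topology
  and smooth functions those with smooth pullback along \<open>P\<close>, with \<open>P\<close> a submersion. For \<open>P\<close> the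
  orbit map of a free proper action this is the usual orbit manifold, which exists and is unique.\<close>

definition quotient_manifold :: "'a mfd \<Rightarrow> ('a \<Rightarrow> 'b) \<Rightarrow> 'b mfd \<Rightarrow> bool" where
  "quotient_manifold X P N \<longleftrightarrow>
     (\<exists>n. manifold n N) \<and> quotient_map (mtop X) (mtop N) P \<and>
     (\<forall>U f. openin (mtop N) U \<longrightarrow> (f \<in> msm N U \<longleftrightarrow> f \<circ> P \<in> msm X {x \<in> pts X. P x \<in> U})) \<and>
     submersion X N P"

text \<open>The map on the quotient of \<open>X\<close> by \<open>P\<close> induced by \<open>F\<close>.\<close>

definition induced_map :: "'a mfd \<Rightarrow> ('a \<Rightarrow> 'b) \<Rightarrow> ('a \<Rightarrow> 'c) \<Rightarrow> 'b \<Rightarrow> 'c" where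
  "induced_map X P F y = F (SOME x. x \<in> pts X \<and> P x = y)"


section \<open>Cosymplectic groupoids\<close>

text \<open>\<open>g\<close> and \<open>h\<close> are composable, with composite \<open>gmult \<G> g h\<close>, if the source of \<open>g\<close> is the target
  of \<open>h\<close>.\<close>

record ('q, 'm) groupoid =
  arrows :: "'q mfd"
  base :: "'m mfd"
  gsrc :: "'q \<Rightarrow> 'm"
  gtgt :: "'q \<Rightarrow> 'm"
  gmult :: "'q \<Rightarrow> 'q \<Rightarrow> 'q"
  gunit :: "'m \<Rightarrow> 'q"
  ginv :: "'q \<Rightarrow> 'q"

definition composable :: "('q, 'm) groupoid \<Rightarrow> ('q \<times> 'q) set" where
  "composable \<G> = {(g, h). g \<in> pts (arrows \<G>) \<and> h \<in> pts (arrows \<G>) \<and> gsrc \<G> g = gtgt \<G> h}"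

definition composable_mfd :: "('q, 'm) groupoid \<Rightarrow> ('q \<times> 'q) mfd" where
  "composable_mfd \<G> = sub_mfd (prod_mfd (arrows \<G>) (arrows \<G>)) (composable \<G>)"

definition lie_groupoid :: "('q, 'm) groupoid \<Rightarrow> bool" where
  "lie_groupoid \<G> \<longleftrightarrow>
     (\<exists>n. manifold n (arrows \<G>)) \<and> (\<exists>m. manifold m (base \<G>)) \<and>
     submersion (arrows \<G>) (base \<G>) (gsrc \<G>) \<and> gsrc \<G> ` pts (arrows \<G>) = pts (base \<G>) \<and>
     submersion (arrows \<G>) (base \<G>) (gtgt \<G>) \<and> gtgt \<G> ` pts (arrows \<G>) = pts (base \<G>) \<and>
     smooth_map (composable_mfd \<G>) (arrows \<G>) (\<lambda>(g, h). gmult \<G> g h) \<and>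
     smooth_map (base \<G>) (arrows \<G>) (gunit \<G>) \<and>
     smooth_map (arrows \<G>) (arrows \<G>) (ginv \<G>) \<and>
     (\<forall>(g, h)\<in>composable \<G>. gsrc \<G> (gmult \<G> g h) = gsrc \<G> h \<and> gtgt \<G> (gmult \<G> g h) = gtgt \<G> g) \<and>
     (\<forall>g h k. (g, h) \<in> composable \<G> \<longrightarrow> (h, k) \<in> composable \<G> \<longrightarrow>
        gmult \<G> (gmult \<G> g h) k = gmult \<G> g (gmult \<G> h k)) \<and>
     (\<forall>x\<in>pts (base \<G>). gsrc \<G> (gunit \<G> x) = x \<and> gtgt \<G> (gunit \<G> x) = x) \<and>
     (\<forall>g\<in>pts (arrows \<G>).
        gmult \<G> (gunit \<G> (gtgt \<G> g)) g = g \<and> gmult \<G> g (gunit \<G> (gsrc \<G> g)) = g \<and>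
        gsrc \<G> (ginv \<G> g) = gtgt \<G> g \<and> gtgt \<G> (ginv \<G> g) = gsrc \<G> g \<and>
        gmult \<G> g (ginv \<G> g) = gunit \<G> (gtgt \<G> g) \<and> gmult \<G> (ginv \<G> g) g = gunit \<G> (gsrc \<G> g))"

definition multiplicative1 :: "('q, 'm) groupoid \<Rightarrow> 'q form1 \<Rightarrow> bool" where
  "multiplicative1 \<G> \<theta> \<longleftrightarrow>
     (\<forall>c v. pullback1 (composable_mfd \<G>) (arrows \<G>) (\<lambda>(g, h). gmult \<G> g h) \<theta> c v =
        pullback1 (composable_mfd \<G>) (arrows \<G>) fst \<theta> c v +
        pullback1 (composable_mfd \<G>) (arrows \<G>) snd \<theta> c v)"

definition multiplicative2 :: "('q, 'm) groupoid \<Rightarrow> 'q form2 \<Rightarrow> bool" where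
  "multiplicative2 \<G> \<theta> \<longleftrightarrow>
     (\<forall>c v w. pullback2 (composable_mfd \<G>) (arrows \<G>) (\<lambda>(g, h). gmult \<G> g h) \<theta> c v w =
        pullback2 (composable_mfd \<G>) (arrows \<G>) fst \<theta> c v w +
        pullback2 (composable_mfd \<G>) (arrows \<G>) snd \<theta> c v w)"

definition cosymplectic_groupoid :: "('q, 'm) groupoid \<Rightarrow> 'q form2 \<Rightarrow> 'q form1 \<Rightarrow> bool" where
  "cosymplectic_groupoid \<G> \<omega> \<eta> \<longleftrightarrow>
     lie_groupoid \<G> \<and> multiplicative2 \<G> \<omega> \<and> multiplicative1 \<G> \<eta> \<and>
     cosymplectic_manifold (arrows \<G>) \<omega> \<eta> \<and>
     (\<exists>m. manifold m (base \<G>) \<and>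
          (\<forall>x\<in>pts (base \<G>). form_rank (arrows \<G>) \<omega> (gunit \<G> x) = 2 * m))"

definition cosymplectic_groupoid_action ::
    "'g monoid \<Rightarrow> 'g mfd \<Rightarrow> ('q, 'm) groupoid \<Rightarrow> 'q form2 \<Rightarrow> 'q form1 \<Rightarrow>
     ('g \<Rightarrow> 'q \<Rightarrow> 'q) \<Rightarrow> ('g \<Rightarrow> 'm \<Rightarrow> 'm) \<Rightarrow> bool" where
  "cosymplectic_groupoid_action G K \<G> \<omega> \<eta> act act0 \<longleftrightarrow>
     smooth_action G K (arrows \<G>) act \<and> smooth_action G K (base \<G>) act0 \<and>
     (\<forall>a\<in>carrier G.
        (\<forall>g\<in>pts (arrows \<G>). gsrc \<G> (act a g) = act0 a (gsrc \<G> g) \<and>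
                               gtgt \<G> (act a g) = act0 a (gtgt \<G> g)) \<and>
        (\<forall>(g, h)\<in>composable \<G>. act a (gmult \<G> g h) = gmult \<G> (act a g) (act a h)) \<and>
        (\<forall>x\<in>pts (base \<G>). act a (gunit \<G> x) = gunit \<G> (act0 a x)) \<and>
        pullback2 (arrows \<G>) (arrows \<G>) (act a) \<omega> = \<omega> \<and>
        pullback1 (arrows \<G>) (arrows \<G>) (act a) \<eta> = \<eta>)"

text \<open>Groupoid morphisms into the abelian group given by the dual of the Lie algebra.\<close>

definition additive_morphism :: "('q, 'm) groupoid \<Rightarrow> ('q \<Rightarrow> 'g tvec \<Rightarrow> real) \<Rightarrow> bool" where
  "additive_morphism \<G> J \<longleftrightarrow>
     (\<forall>(g, h)\<in>composable \<G>. J (gmult \<G> g h) = (\<lambda>v. J g v + J h v))"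

end

theory Submission
  imports Defs
begin

text \<open>Both reduced forms are characterised by their pullbacks to a zero level set, and the whole
  statement is the naturality of this characterisation. Let \<open>Q\<close> be the arrow manifold. The inclusion of the leaf restricts to a
  smooth map of zero level sets \<open>j : Z0 \<rightarrow> Z\<close>, and \<open>Lred \<circ> P0 = P \<circ> j\<close>. Hence
  \<^item> \<open>P0\<^sup>* Lred\<^sup>* \<omega>red = j\<^sup>* P\<^sup>* \<omega>red = j\<^sup>* i\<^sup>* \<omega>\<close>, the pullback of \<open>\<omega>\<close> along \<open>Z0 \<subseteq> Z \<subseteq> Q\<close>;
  \<^item> \<open>P0\<^sup>* \<sigma>red = L0\<^sup>* L\<^sup>* \<omega>\<close>, the pullback of \<open>\<omega>\<close> along \<open>Z0 \<subseteq> \<Sigma> \<subseteq> Q\<close>.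

  The two composite inclusions agree, and \<open>P0\<close> is a surjective submersion, so that pullback along
  it is injective on forms (\<open>pullback2_submersion_cancel\<close>).

  Functoriality of the pullback (\<open>pullback2_compose\<close>) is only available along smooth maps. The leaf
  is merely immersed, so smoothness of \<open>j\<close> is not a matter of restricting to a subspace of \<open>Q\<close>: it
  follows from smoothness of the immersion \<open>\<Sigma> \<rightarrow> Q\<close> (\<open>smooth_map_sub_mfd\<close>). Smoothness of \<open>Lred\<close>
  comes from the universal property of the quotient manifold (\<open>quotient_manifold_universal\<close>).\<close>

section \<open>Functional structures and smooth maps\<close>

lemma functional_structureD:
  assumes "functional_structure X" and "openin (mtop X) U"
  shows functional_structure_cong: "\<And>f g. f \<in> msm X U \<Longrightarrow> (\<And>x. x \<in> U \<Longrightarrow> f x = g x) \<Longrightarrow> g \<in> msm X U"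
    and functional_structure_continuous:
      "\<And>f. f \<in> msm X U \<Longrightarrow> continuous_map (subtopology (mtop X) U) euclideanreal f"
    and functional_structure_const: "\<And>c. (\<lambda>_. c) \<in> msm X U"
    and functional_structure_add:
      "\<And>f g. f \<in> msm X U \<Longrightarrow> g \<in> msm X U \<Longrightarrow> (\<lambda>x. f x + g x) \<in> msm X U"
    and functional_structure_mult:
      "\<And>f g. f \<in> msm X U \<Longrightarrow> g \<in> msm X U \<Longrightarrow> (\<lambda>x. f x * g x) \<in> msm X U"
    and functional_structure_restrict:
      "\<And>f V. f \<in> msm X U \<Longrightarrow> openin (mtop X) V \<Longrightarrow> V \<subseteq> U \<Longrightarrow> f \<in> msm X V"
  using assms unfolding functional_structure_def by meson+

lemma manifold_functional_structure: "manifold n X \<Longrightarrow> functional_structure X"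
  by (simp add: manifold_def)

lemma smooth_map_compose:
  assumes F: "smooth_map X Y F" and H: "smooth_map Y W H"
  shows "smooth_map X W (H \<circ> F)"
proof -
  have "(k \<circ> (H \<circ> F)) \<in> msm X {x \<in> pts X. (H \<circ> F) x \<in> V}"
    if V: "openin (mtop W) V" and k: "k \<in> msm W V" for V k
  proof -
    have cH: "continuous_map (mtop Y) (mtop W) H" using H by (simp add: smooth_map_def)
    have "k \<circ> H \<in> msm Y {y \<in> pts Y. H y \<in> V}"
      using H V k by (simp add: smooth_map_def)
    moreover have "openin (mtop Y) {y \<in> pts Y. H y \<in> V}"
      using cH V by (rule openin_continuous_map_preimage)
    ultimately have "k \<circ> H \<circ> F \<in> msm X {x \<in> pts X. F x \<in> {y \<in> pts Y. H y \<in> V}}"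
      using F unfolding smooth_map_def by blast
    moreover have "{x \<in> pts X. F x \<in> {y \<in> pts Y. H y \<in> V}} = {x \<in> pts X. (H \<circ> F) x \<in> V}"
      using F unfolding smooth_map_def continuous_map_def by auto
    ultimately show ?thesis by (simp add: comp_assoc)
  qed
  then show ?thesis
    using F H unfolding smooth_map_def by (blast intro: continuous_map_compose)
qed

lemma smooth_map_pts: "smooth_map X Y F \<Longrightarrow> p \<in> pts X \<Longrightarrow> F p \<in> pts Y"
  unfolding smooth_map_def continuous_map_def by auto

lemma smooth_map_Csm:
  assumes "smooth_map X Y F" "h \<in> Csm Y"
  shows "h \<circ> F \<in> Csm X"
proof -
  have "{x \<in> pts X. F x \<in> pts Y} = pts X"
    using smooth_map_pts[OF assms(1)] by blast
  then show ?thesis using assms unfolding smooth_map_def by (metis openin_topspace)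
qed

lemma pts_sub_mfd: "pts (sub_mfd X S) = pts X \<inter> S"
  by (simp add: sub_mfd_def)

lemma sub_mfd_smooth_extension:
  assumes "f \<in> msm (sub_mfd X S) U" "p \<in> U"
  obtains V h where "openin (mtop X) V" "p \<in> V" "h \<in> msm X V" "\<And>x. x \<in> V \<inter> U \<Longrightarrow> f x = h x"
  using assms unfolding sub_mfd_def by force

lemma sub_mfd_smoothI:
  assumes "\<And>p. p \<in> U \<Longrightarrow>
    \<exists>V h. openin (mtop X) V \<and> p \<in> V \<and> h \<in> msm X V \<and> (\<forall>x\<in>V \<inter> U. f x = h x)"
  shows "f \<in> msm (sub_mfd X S) U"
  using assms by (simp add: sub_mfd_def)

text \<open>Sums and products of locally extendable functions extend to the intersection of the two
  domains of extension.\<close>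

lemma sub_mfd_smooth_common_extension:
  assumes X: "functional_structure X"
    and f: "f \<in> msm (sub_mfd X S) U" and g: "g \<in> msm (sub_mfd X S) U" and p: "p \<in> U"
  obtains V h k where "openin (mtop X) V" "p \<in> V" "h \<in> msm X V" "k \<in> msm X V"
    "\<And>x. x \<in> V \<inter> U \<Longrightarrow> f x = h x" "\<And>x. x \<in> V \<inter> U \<Longrightarrow> g x = k x"
proof -
  obtain V1 h where 1: "openin (mtop X) V1" "p \<in> V1" "h \<in> msm X V1" "\<And>x. x \<in> V1 \<inter> U \<Longrightarrow> f x = h x"
    using sub_mfd_smooth_extension[OF f p] by blast
  obtain V2 k where 2: "openin (mtop X) V2" "p \<in> V2" "k \<in> msm X V2" "\<And>x. x \<in> V2 \<inter> U \<Longrightarrow> g x = k x"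
    using sub_mfd_smooth_extension[OF g p] by blast
  have V: "openin (mtop X) (V1 \<inter> V2)" using 1 2 by blast
  show thesis
    by (rule that[OF V, of h k])
      (use 1 2 functional_structure_restrict[OF X _ _ V] in auto)
qed

text \<open>Zero level sets carry the structure of \<open>sub_mfd\<close>; this makes their smooth functions an algebra,
  which the calculus of derivations on them relies on.\<close>

lemma functional_structure_sub_mfd:
  assumes X: "functional_structure X"
  shows "functional_structure (sub_mfd X S)"
proof -
  let ?Y = "sub_mfd X S"
  have top: "mtop ?Y = subtopology (mtop X) S" by (simp add: sub_mfd_def)
  have sub: "U \<subseteq> pts X \<inter> S" if "openin (mtop ?Y) U" for U
    using openin_subset[OF that] by (simp add: pts_sub_mfd)
  have cong: "g \<in> msm ?Y U" if "f \<in> msm ?Y U" "\<forall>x\<in>U. f x = g x" for U f g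
    using that by (simp add: sub_mfd_def)
  have cont: "continuous_map (subtopology (mtop ?Y) U) euclideanreal f"
    if U: "openin (mtop ?Y) U" and f: "f \<in> msm ?Y U" for U f
  proof -
    have eq: "subtopology (mtop ?Y) U = subtopology (mtop X) U"
      using sub[OF U] by (simp add: top subtopology_subtopology inf.absorb2)
    have "\<exists>N. openin (subtopology (mtop X) U) N \<and> p \<in> N \<and>
        continuous_map (subtopology (subtopology (mtop X) U) N) euclideanreal f"
      if p: "p \<in> topspace (subtopology (mtop X) U)" for p
    proof -
      have pU: "p \<in> U" using p by simp
      obtain V h where V: "openin (mtop X) V" "p \<in> V" "h \<in> msm X V" "\<And>x. x \<in> V \<inter> U \<Longrightarrow> f x = h x"
        using sub_mfd_smooth_extension[OF f pU] by blast
      have "continuous_map (subtopology (mtop X) V) euclideanreal h"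
        using functional_structure_continuous[OF X] V by blast
      then have "continuous_map (subtopology (mtop X) (V \<inter> U)) euclideanreal h"
        by (metis continuous_map_from_subtopology subtopology_subtopology)
      then have "continuous_map (subtopology (mtop X) (V \<inter> U)) euclideanreal f"
        by (rule continuous_map_eq) (use V(4) in auto)
      then have "continuous_map (subtopology (subtopology (mtop X) U) (V \<inter> U)) euclideanreal f"
        by (simp add: subtopology_subtopology inf_commute inf_left_commute)
      moreover have "openin (subtopology (mtop X) U) (V \<inter> U)"
        using V(1) by (auto simp: openin_subtopology)
      ultimately show ?thesis using V(2) pU by blast
    qed
    then obtain N where N: "\<And>p. p \<in> topspace (subtopology (mtop X) U) \<Longrightarrow>
        openin (subtopology (mtop X) U) (N p) \<and> p \<in> N p \<and>
        continuous_map (subtopology (subtopology (mtop X) U) (N p)) euclideanreal f"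
      by metis
    have "continuous_map (subtopology (mtop X) U) euclideanreal f"
      by (rule pasting_lemma[where I = "topspace (subtopology (mtop X) U)" and T = N and f = "\<lambda>_. f"])
        (use N in auto)
    then show ?thesis by (simp only: eq)
  qed
  have const: "(\<lambda>_. c) \<in> msm ?Y U" if "openin (mtop ?Y) U" for U c
    by (rule sub_mfd_smoothI)
      (use sub[OF that] functional_structure_const[OF X openin_topspace] in blast)
  have add: "(\<lambda>x. f x + g x) \<in> msm ?Y U" if fg: "f \<in> msm ?Y U" "g \<in> msm ?Y U" for U f g
  proof (rule sub_mfd_smoothI)
    fix p assume "p \<in> U"
    then obtain V h k where "openin (mtop X) V" "p \<in> V" "h \<in> msm X V" "k \<in> msm X V"
      "\<And>x. x \<in> V \<inter> U \<Longrightarrow> f x = h x" "\<And>x. x \<in> V \<inter> U \<Longrightarrow> g x = k x"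
      using sub_mfd_smooth_common_extension[OF X fg] by blast
    then show "\<exists>V h. openin (mtop X) V \<and> p \<in> V \<and> h \<in> msm X V \<and> (\<forall>x\<in>V \<inter> U. f x + g x = h x)"
      by (intro exI[of _ V] exI[of _ "\<lambda>x. h x + k x"]) (auto intro: functional_structure_add[OF X])
  qed
  have mult: "(\<lambda>x. f x * g x) \<in> msm ?Y U" if fg: "f \<in> msm ?Y U" "g \<in> msm ?Y U" for U f g
  proof (rule sub_mfd_smoothI)
    fix p assume "p \<in> U"
    then obtain V h k where "openin (mtop X) V" "p \<in> V" "h \<in> msm X V" "k \<in> msm X V"
      "\<And>x. x \<in> V \<inter> U \<Longrightarrow> f x = h x" "\<And>x. x \<in> V \<inter> U \<Longrightarrow> g x = k x"
      using sub_mfd_smooth_common_extension[OF X fg] by blast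
    then show "\<exists>V h. openin (mtop X) V \<and> p \<in> V \<and> h \<in> msm X V \<and> (\<forall>x\<in>V \<inter> U. f x * g x = h x)"
      by (intro exI[of _ V] exI[of _ "\<lambda>x. h x * k x"]) (auto intro: functional_structure_mult[OF X])
  qed
  have restrict: "f \<in> msm ?Y V" if "f \<in> msm ?Y U" "V \<subseteq> U" for U V f
  proof (rule sub_mfd_smoothI)
    fix p assume "p \<in> V"
    then have "p \<in> U" using \<open>V \<subseteq> U\<close> by blast
    then obtain W h where "openin (mtop X) W" "p \<in> W" "h \<in> msm X W" "\<And>x. x \<in> W \<inter> U \<Longrightarrow> f x = h x"
      using sub_mfd_smooth_extension[OF \<open>f \<in> msm ?Y U\<close>] by blast
    then show "\<exists>W h. openin (mtop X) W \<and> p \<in> W \<and> h \<in> msm X W \<and> (\<forall>x\<in>W \<inter> V. f x = h x)"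
      using \<open>V \<subseteq> U\<close> by (intro exI[of _ W] exI[of _ h]) blast
  qed
  have glue: "f \<in> msm ?Y (\<Union>\<U>)" if \<U>: "\<forall>U\<in>\<U>. openin (mtop ?Y) U \<and> f \<in> msm ?Y U" for \<U> f
  proof (rule sub_mfd_smoothI)
    fix p assume "p \<in> \<Union>\<U>"
    then obtain U where U: "U \<in> \<U>" "p \<in> U" by blast
    obtain T where T: "openin (mtop X) T" "U = T \<inter> S"
      using U \<U> by (metis top openin_subtopology)
    obtain V h where V: "openin (mtop X) V" "p \<in> V" "h \<in> msm X V" "\<And>x. x \<in> V \<inter> U \<Longrightarrow> f x = h x"
      using sub_mfd_smooth_extension U \<U> by metis
    \<comment> \<open>\<open>h\<close> need not agree with \<open>f\<close> on the other members of the cover; inside \<open>T\<close> these have only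
      points of \<open>U\<close>.\<close>
    have "V \<inter> T \<inter> \<Union>\<U> \<subseteq> V \<inter> U"
      using \<U> sub T(2) by blast
    moreover have "openin (mtop X) (V \<inter> T)" using V T by blast
    moreover have "h \<in> msm X (V \<inter> T)"
      using functional_structure_restrict[OF X V(1,3)] \<open>openin (mtop X) (V \<inter> T)\<close> by blast
    ultimately show "\<exists>V h. openin (mtop X) V \<and> p \<in> V \<and> h \<in> msm X V \<and> (\<forall>x\<in>V \<inter> \<Union>\<U>. f x = h x)"
      using U V T by (intro exI[of _ "V \<inter> T"] exI[of _ h]) blast
  qed
  show ?thesis
    unfolding functional_structure_def
    by (intro conjI allI impI)
      (erule (1) cong cont add mult restrict | erule const glue)+
qed

text \<open>If \<open>k\<close> extends \<open>h\<close> near \<open>F p\<close>, then \<open>k \<circ> F\<close> extends \<open>h \<circ> F\<close> near \<open>p\<close>. Since \<open>F\<close> is an arbitrary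
  smooth map, \<open>X\<close> may be a leaf whose topology is finer than that of its image.\<close>

lemma smooth_map_sub_mfd:
  assumes F: "smooth_map X Y F" and ST: "F ` (pts X \<inter> S) \<subseteq> T"
  shows "smooth_map (sub_mfd X S) (sub_mfd Y T) F"
proof -
  have cF: "continuous_map (mtop X) (mtop Y) F" using F by (simp add: smooth_map_def)
  have "continuous_map (mtop (sub_mfd X S)) (mtop (sub_mfd Y T)) F"
    using cF ST
    by (auto simp: sub_mfd_def continuous_map_in_subtopology continuous_map_from_subtopology)
  moreover have "h \<circ> F \<in> msm (sub_mfd X S) {x \<in> pts (sub_mfd X S). F x \<in> U}"
    if h: "h \<in> msm (sub_mfd Y T) U" for U h
  proof (rule sub_mfd_smoothI)
    fix p assume p: "p \<in> {x \<in> pts (sub_mfd X S). F x \<in> U}"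
    then have "F p \<in> U" and pX: "p \<in> pts X" by (auto simp: pts_sub_mfd)
    then obtain V k where V: "openin (mtop Y) V" "F p \<in> V" "k \<in> msm Y V"
      "\<And>y. y \<in> V \<inter> U \<Longrightarrow> h y = k y"
      using sub_mfd_smooth_extension[OF h] by metis
    let ?V = "{x \<in> pts X. F x \<in> V}"
    have "openin (mtop X) ?V" using openin_continuous_map_preimage[OF cF V(1)] .
    moreover have "k \<circ> F \<in> msm X ?V" using F V unfolding smooth_map_def by blast
    ultimately show "\<exists>V k. openin (mtop X) V \<and> p \<in> V \<and> k \<in> msm X V \<and>
        (\<forall>x\<in>V \<inter> {x \<in> pts (sub_mfd X S). F x \<in> U}. (h \<circ> F) x = k x)"
      using V pX by (intro exI[of _ ?V] exI[of _ "k \<circ> F"]) auto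
  qed
  ultimately show ?thesis by (simp add: smooth_map_def)
qed

lemma smooth_map_sub_mfd_inclusion:
  assumes X: "functional_structure X"
  shows "smooth_map (sub_mfd X S) X id"
proof -
  have "h \<circ> id \<in> msm (sub_mfd X S) {x \<in> pts (sub_mfd X S). id x \<in> V}"
    if "openin (mtop X) V" "h \<in> msm X V" for V h
    by (rule sub_mfd_smoothI) (use that in auto)
  moreover have "continuous_map (mtop (sub_mfd X S)) (mtop X) id"
    by (simp add: sub_mfd_def continuous_map_from_subtopology)
  ultimately show ?thesis by (simp add: smooth_map_def)
qed

text \<open>Both the topology and the smooth functions of a quotient manifold are detected by composing
  with the projection, so a map out of it is smooth as soon as its composite with the projection
  is.\<close>

lemma quotient_manifold_universal:
  assumes X: "functional_structure X" and N: "quotient_manifold X P N"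
    and H: "smooth_map X Y H" and FP: "\<And>x. x \<in> pts X \<Longrightarrow> F (P x) = H x"
  shows "smooth_map N Y F"
proof -
  have q: "quotient_map (mtop X) (mtop N) P" using N by (simp add: quotient_manifold_def)
  have PN: "P ` pts X = pts N" using quotient_imp_surjective_map[OF q] .
  have cH: "continuous_map (mtop X) (mtop Y) H" using H by (simp add: smooth_map_def)
  then have "continuous_map (mtop X) (mtop Y) (F \<circ> P)"
    by (rule continuous_map_eq) (simp add: FP)
  then have cF: "continuous_map (mtop N) (mtop Y) F"
    by (rule continuous_compose_quotient_map[OF q])
  moreover have "h \<circ> F \<in> msm N {y \<in> pts N. F y \<in> V}"
    if V: "openin (mtop Y) V" and h: "h \<in> msm Y V" for V h
  proof -
    have eq: "{x \<in> pts X. P x \<in> {y \<in> pts N. F y \<in> V}} = {x \<in> pts X. H x \<in> V}"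
      using PN by (auto simp: FP)
    have "h \<circ> H \<in> msm X {x \<in> pts X. H x \<in> V}"
      using H V h by (simp add: smooth_map_def)
    then have "h \<circ> F \<circ> P \<in> msm X {x \<in> pts X. H x \<in> V}"
      by (rule functional_structure_cong[OF X openin_continuous_map_preimage[OF cH V]])
        (simp add: FP)
    moreover have "openin (mtop N) {y \<in> pts N. F y \<in> V}"
      using openin_continuous_map_preimage[OF cF V] .
    ultimately show ?thesis
      using N unfolding quotient_manifold_def eq[symmetric] by blast
  qed
  ultimately show ?thesis by (simp add: smooth_map_def)
qed

section \<open>Tangent maps and pullbacks\<close>

lemma push_in_tspace:
  assumes Y: "functional_structure Y" and F: "smooth_map X Y F" and v: "v \<in> tspace X p"
  shows "push Y F v \<in> tspace Y (F p)"
proof -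
  note C = smooth_map_Csm[OF F]
  note add = functional_structure_add[OF Y openin_topspace]
  note mult = functional_structure_mult[OF Y openin_topspace]
  have scale: "(\<lambda>x. a * f x) \<in> Csm Y" if "f \<in> Csm Y" for a f
    by (rule mult[OF functional_structure_const[OF Y openin_topspace] that])
  have "push Y F v (\<lambda>x. a * f x + b * g x) = a * push Y F v f + b * push Y F v g"
    if f: "f \<in> Csm Y" and g: "g \<in> Csm Y" for f g a b
  proof -
    have "v (\<lambda>x. a * (f \<circ> F) x + b * (g \<circ> F) x) = a * v (f \<circ> F) + b * v (g \<circ> F)"
      using v C[OF f] C[OF g] unfolding tspace_def by blast
    then show ?thesis using f g add[OF scale[OF f] scale[OF g]] by (simp add: push_def comp_def)
  qed
  moreover have "push Y F v (\<lambda>x. f x * g x) = f (F p) * push Y F v g + g (F p) * push Y F v f"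
    if f: "f \<in> Csm Y" and g: "g \<in> Csm Y" for f g
  proof -
    have "v (\<lambda>x. (f \<circ> F) x * (g \<circ> F) x) = (f \<circ> F) p * v (g \<circ> F) + (g \<circ> F) p * v (f \<circ> F)"
      using v C[OF f] C[OF g] unfolding tspace_def by blast
    then show ?thesis using f g mult[OF f g] by (simp add: push_def comp_def)
  qed
  ultimately show ?thesis by (auto simp: tspace_def push_def)
qed

lemma push_push: "smooth_map Y W H \<Longrightarrow> push W H (push Y F v) = push W (H \<circ> F) v"
  by (auto simp: push_def fun_eq_iff comp_assoc dest: smooth_map_Csm)

text \<open>A difference \<open>d\<close> of two functions that agree on the points equals \<open>d\<close> times the indicator of
  the complement of the points, and both factors are smooth and vanish at \<open>p\<close>, so the Leibniz rule
  gives \<open>v d = 0\<close>.\<close>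

lemma tangent_vector_cong:
  assumes X: "functional_structure X" and v: "v \<in> tspace X p" and p: "p \<in> pts X"
    and f: "f \<in> Csm X" and fg: "\<And>x. x \<in> pts X \<Longrightarrow> f x = g x"
  shows "v f = v g"
proof -
  have g: "g \<in> Csm X" by (rule functional_structure_cong[OF X openin_topspace f fg])
  have zero: "h \<in> Csm X" if "\<And>x. x \<in> pts X \<Longrightarrow> h x = 0" for h
    by (rule functional_structure_cong[OF X openin_topspace
          functional_structure_const[OF X openin_topspace, of 0]]) (simp add: that)
  define d where "d = (\<lambda>x. 1 * f x + (- 1) * g x)"
  define c where "c = (\<lambda>x. if x \<in> pts X then 0 else 1 :: real)"
  have d0: "d x = 0" if "x \<in> pts X" for x using fg[OF that] by (simp add: d_def)
  have "d \<in> Csm X" "c \<in> Csm X" by (rule zero, simp add: d0 c_def)+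
  then have "v (\<lambda>x. d x * c x) = d p * v c + c p * v d"
    using v unfolding tspace_def by blast
  moreover have "(\<lambda>x. d x * c x) = d" using d0 by (auto simp: c_def)
  ultimately have "v d = 0" using p by (simp add: d0 c_def)
  moreover have "v d = 1 * v f + (- 1) * v g"
    using v f g unfolding tspace_def d_def by blast
  ultimately show ?thesis by simp
qed

lemma push_cong:
  assumes X: "functional_structure X" and F: "smooth_map X Y F"
    and v: "v \<in> tspace X p" and p: "p \<in> pts X"
    and FF': "\<And>x. x \<in> pts X \<Longrightarrow> F x = F' x"
  shows "push Y F v = push Y F' v"
  using tangent_vector_cong[OF X v p smooth_map_Csm[OF F]] FF'
  by (fastforce simp: push_def)

lemma pullback2_cong:
  assumes "functional_structure X" "smooth_map X Y F" "\<And>x. x \<in> pts X \<Longrightarrow> F x = F' x"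
  shows "pullback2 X Y F \<theta> = pullback2 X Y F' \<theta>"
proof -
  have "push Y F v = push Y F' v" if "p \<in> pts X" "v \<in> tspace X p" for p v
    by (rule push_cong[OF assms(1,2) that(2,1) assms(3)])
  then show ?thesis by (auto simp: pullback2_def assms(3) intro!: ext)
qed

lemma pullback2_compose:
  assumes "functional_structure Y" and F: "smooth_map X Y F" and H: "smooth_map Y W H"
  shows "pullback2 X Y F (pullback2 Y W H \<theta>) = pullback2 X W (H \<circ> F) \<theta>"
  by (intro ext)
    (simp add: pullback2_def push_in_tspace[OF assms(1) F] smooth_map_pts[OF F] push_push[OF H])

lemma pullback2_support:
  "pullback2 X Y F \<theta> p v w \<noteq> 0 \<Longrightarrow> p \<in> pts X \<and> v \<in> tspace X p \<and> w \<in> tspace X p"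
  by (simp add: pullback2_def split: if_splits)

lemma two_form_support:
  assumes \<theta>: "two_form X \<theta>" and "\<theta> p v w \<noteq> 0"
  shows "p \<in> pts X \<and> v \<in> tspace X p \<and> w \<in> tspace X p"
proof -
  have p: "p \<in> pts X" using assms by (metis two_form_def)
  then have "linear_functional X p (\<lambda>w. \<theta> p v w)" "linear_functional X p (\<lambda>v. \<theta> p v w)"
    using \<theta> by (auto simp: two_form_def)
  then show ?thesis using p assms(2) unfolding linear_functional_def by blast
qed

text \<open>A surjective submersion lifts every point, and every pair of tangent vectors there, so the
  pullback sees all values of a form. The support hypotheses fix the default values, which the
  pullback cannot see.\<close>

lemma pullback2_submersion_cancel:
  assumes P: "submersion X N P" "P ` pts X = pts N"
    and \<theta>: "\<And>p v w. \<theta> p v w \<noteq> 0 \<Longrightarrow> p \<in> pts N \<and> v \<in> tspace N p \<and> w \<in> tspace N p"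
    and \<sigma>: "\<And>p v w. \<sigma> p v w \<noteq> 0 \<Longrightarrow> p \<in> pts N \<and> v \<in> tspace N p \<and> w \<in> tspace N p"
    and eq: "pullback2 X N P \<theta> = pullback2 X N P \<sigma>"
  shows "\<theta> = \<sigma>"
proof (intro ext)
  fix y v w
  show "\<theta> y v w = \<sigma> y v w"
  proof (cases "y \<in> pts N \<and> v \<in> tspace N y \<and> w \<in> tspace N y")
    case True
    then obtain x where x: "x \<in> pts X" "y = P x" using P(2) by blast
    then have "tspace N y = push N P ` tspace X x" using P(1) by (simp add: submersion_def)
    then obtain v' w' where "v' \<in> tspace X x" "v = push N P v'" "w' \<in> tspace X x" "w = push N P w'"
      using True by blast
    then show ?thesis
      using x fun_cong[OF fun_cong[OF fun_cong[OF eq, of x], of v'], of w']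
      by (simp add: pullback2_def)
  next
    case False
    then show ?thesis using \<theta> \<sigma> by metis
  qed
qed

section \<open>Reduction commutes with restriction to the leaf\<close>

text \<open>In a commuting square \<open>f \<circ> P0 = P \<circ> F\<close> one has \<open>P0\<^sup>* f\<^sup>* \<theta> = F\<^sup>* P\<^sup>* \<theta>\<close>, and \<open>P0\<^sup>*\<close> is injective,
  so \<open>f\<^sup>* \<theta>\<close> is the only two-form on the quotient that pulls back to \<open>F\<^sup>* P\<^sup>* \<theta>\<close>.\<close>

lemma pullback2_descends:
  assumes X0: "functional_structure X0" and X: "functional_structure X"
    and N0: "functional_structure N0"
    and P0: "quotient_manifold X0 P0 N0" and P: "smooth_map X N P"
    and F: "smooth_map X0 X F" and square: "\<And>x. x \<in> pts X0 \<Longrightarrow> f (P0 x) = P (F x)"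
    and \<sigma>: "two_form N0 \<sigma>"
    and eq: "pullback2 X0 X F (pullback2 X N P \<theta>) = pullback2 X0 N0 P0 \<sigma>"
  shows "pullback2 N0 N f \<theta> = \<sigma>"
proof -
  have PF: "smooth_map X0 N (P \<circ> F)" using F P by (rule smooth_map_compose)
  have f: "smooth_map N0 N f"
    by (rule quotient_manifold_universal[OF X0 P0 PF]) (simp add: square)
  have sub: "submersion X0 N0 P0" using P0 by (simp add: quotient_manifold_def)
  then have sm: "smooth_map X0 N0 P0" by (simp add: submersion_def)
  have surj: "P0 ` pts X0 = pts N0"
    using P0 by (simp add: quotient_manifold_def quotient_imp_surjective_map)
  have "pullback2 X0 N0 P0 (pullback2 N0 N f \<theta>) = pullback2 X0 N (f \<circ> P0) \<theta>"
    by (rule pullback2_compose[OF N0 sm f])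
  also have "\<dots> = pullback2 X0 N (P \<circ> F) \<theta>"
    by (rule pullback2_cong[OF X0 smooth_map_compose[OF sm f]]) (simp add: square)
  also have "\<dots> = pullback2 X0 X F (pullback2 X N P \<theta>)"
    by (rule pullback2_compose[OF X F P, symmetric])
  finally have pb: "pullback2 X0 N0 P0 (pullback2 N0 N f \<theta>) = pullback2 X0 N0 P0 \<sigma>"
    using eq by simp
  show ?thesis
    by (rule pullback2_submersion_cancel[OF sub surj pullback2_support two_form_support[OF \<sigma>] pb])
qed

theorem theorem4p8:
  fixes \<G> :: "('q, 'm) groupoid" and \<omega> :: "'q form2" and \<eta> :: "'q form1"
    and \<xi> :: "'q \<Rightarrow> 'q tvec"
    and G :: "'g monoid" and K :: "'g mfd"
    and act :: "'g \<Rightarrow> 'q \<Rightarrow> 'q" and act0 :: "'g \<Rightarrow> 'm \<Rightarrow> 'm"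
    and J J0 :: "'q \<Rightarrow> 'g tvec \<Rightarrow> real"
    and \<Sigma> :: "'q mfd" and L :: "'q \<Rightarrow> 'q"
    and Z Z0 :: "'q mfd" and i L0 :: "'q \<Rightarrow> 'q"
    and R R0 :: "'q set mfd" and P P0 :: "'q \<Rightarrow> 'q set"
    and \<omega>red \<sigma>red :: "'q set form2" and Lred :: "'q set \<Rightarrow> 'q set"
  assumes "cosymplectic_groupoid \<G> \<omega> \<eta>"
    and "connected_space (mtop (arrows \<G>))"
    and "reeb_field (arrows \<G>) \<omega> \<eta> \<xi>"
    and "lie_group G K"
    and "cosymplectic_groupoid_action G K \<G> \<omega> \<eta> act act0"
    and "free_action G (base \<G>) act0"
    and "proper_action K (base \<G>) act0"
    and "cosymplectic_moment_map G K (arrows \<G>) \<omega> \<eta> \<xi> act J"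
    and "additive_morphism \<G> J"
    and "\<forall>v\<in>lie_algebra G K. \<forall>p\<in>pts (arrows \<G>). \<xi> p (\<lambda>x. J x v) = 0"
    \<comment> \<open>the leaf through the units, its inclusion, and the restricted moment map\<close>
    and "symplectic_leaf (arrows \<G>) \<eta> \<Sigma>" and "gunit \<G> ` pts (base \<G>) \<subseteq> pts \<Sigma>"
    and "L = id" and "J0 = J \<circ> L"
    \<comment> \<open>the reduced space of the groupoid and its reduced form\<close>
    and "Z = zero_level (arrows \<G>) J" and "i = id"
    and "P = orbit G act" and "quotient_manifold Z P R"
    and "two_form R \<omega>red" and "pullback2 Z (arrows \<G>) i \<omega> = pullback2 Z R P \<omega>red"
    \<comment> \<open>the reduced space of the leaf and its reduced form\<close>
    and "Z0 = zero_level \<Sigma> J0" and "L0 = id"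
    and "P0 = orbit G act" and "quotient_manifold Z0 P0 R0"
    and "two_form R0 \<sigma>red"
    and "pullback2 Z0 \<Sigma> L0 (pullback2 \<Sigma> (arrows \<G>) L \<omega>) = pullback2 Z0 R0 P0 \<sigma>red"
    \<comment> \<open>the map induced by \<open>L\<close>\<close>
    and "Lred = induced_map Z0 P0 (P \<circ> L)"
  shows "pullback2 R0 R Lred \<omega>red = \<sigma>red"
proof -
  let ?Q = "arrows \<G>"
  have "lie_groupoid \<G>" using \<open>cosymplectic_groupoid \<G> \<omega> \<eta>\<close> by (simp add: cosymplectic_groupoid_def)
  then have Q: "functional_structure ?Q"
    unfolding lie_groupoid_def using manifold_functional_structure by blast
  have leaf: "integral_manifold ?Q \<eta> \<Sigma>"
    using \<open>symplectic_leaf ?Q \<eta> \<Sigma>\<close> by (simp add: symplectic_leaf_def)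
  then have S: "functional_structure \<Sigma>" and LQ: "smooth_map \<Sigma> ?Q id"
    unfolding integral_manifold_def using manifold_functional_structure by blast+
  let ?C = "{x \<in> pts ?Q. J x = (\<lambda>_. 0)}" and ?D = "{x \<in> pts \<Sigma>. J0 x = (\<lambda>_. 0)}"
  have Zeq: "Z = sub_mfd ?Q ?C" and Z0eq: "Z0 = sub_mfd \<Sigma> ?D"
    using \<open>Z = zero_level ?Q J\<close> \<open>Z0 = zero_level \<Sigma> J0\<close> by (simp_all add: zero_level_def)
  have Z: "functional_structure Z" and Z0: "functional_structure Z0"
    unfolding Zeq Z0eq using Q S by (auto intro: functional_structure_sub_mfd)
  have P0: "quotient_manifold Z0 P0 R0" using assms by simp
  then have R0: "functional_structure R0"
    unfolding quotient_manifold_def by (blast intro: manifold_functional_structure)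
  have P: "smooth_map Z R P" using \<open>quotient_manifold Z P R\<close> by (simp add: quotient_manifold_def submersion_def)
  have iZ: "smooth_map Z ?Q id" and iZ0: "smooth_map Z0 \<Sigma> id"
    unfolding Zeq Z0eq using Q S by (auto intro: smooth_map_sub_mfd_inclusion)
  have j: "smooth_map Z0 Z id"
    unfolding Zeq Z0eq
  proof (rule smooth_map_sub_mfd[OF LQ])
    show "id ` (pts \<Sigma> \<inter> ?D) \<subseteq> ?C"
      using smooth_map_pts[OF LQ] \<open>J0 = J \<circ> L\<close> \<open>L = id\<close> by auto
  qed
  \<comment> \<open>Both projections are the orbit map, so every choice of representative made by the induced map
    gives the same orbit, and the induced map fixes each orbit.\<close>
  have square: "Lred (P0 x) = P (id x)" if "x \<in> pts Z0" for x
  proof -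
    have "P0 (SOME x'. x' \<in> pts Z0 \<and> P0 x' = P0 x) = P0 x"
      by (rule someI2[of _ x]) (use that in auto)
    then show ?thesis using \<open>Lred = induced_map Z0 P0 (P \<circ> L)\<close> \<open>L = id\<close>
        \<open>P = orbit G act\<close> \<open>P0 = orbit G act\<close>
      by (simp add: induced_map_def)
  qed
  have "pullback2 Z0 Z id (pullback2 Z R P \<omega>red) = pullback2 Z0 Z id (pullback2 Z ?Q id \<omega>)"
    using \<open>pullback2 Z ?Q i \<omega> = pullback2 Z R P \<omega>red\<close> \<open>i = id\<close> by simp
  also have "\<dots> = pullback2 Z0 ?Q id \<omega>"
    using pullback2_compose[OF Z j iZ] by simp
  also have "\<dots> = pullback2 Z0 \<Sigma> id (pullback2 \<Sigma> ?Q id \<omega>)"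
    using pullback2_compose[OF S iZ0 LQ] by simp
  also have "\<dots> = pullback2 Z0 R0 P0 \<sigma>red"
    using \<open>pullback2 Z0 \<Sigma> L0 (pullback2 \<Sigma> ?Q L \<omega>) = pullback2 Z0 R0 P0 \<sigma>red\<close> \<open>L0 = id\<close> \<open>L = id\<close>
    by simp
  finally have restricted: "pullback2 Z0 Z id (pullback2 Z R P \<omega>red) = pullback2 Z0 R0 P0 \<sigma>red" .
  show ?thesis
    by (rule pullback2_descends[OF Z0 Z R0 P0 P j _ \<open>two_form R0 \<sigma>red\<close> restricted]) (rule square)
qed

end
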